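(* Let $W:[0,\infty)\to[0,\infty)$ be such that $W(1)=0$, $W$ is decreasing on $(0,1]$ and increasing on $[1,\infty)$, and $W'(t)$ is non-decreasing on $(0,\infty)$. Suppose that, for every fixed $\lambda\ge1$ and $t>0$ (with $f(\cdot\mid t/\lambda)$ well defined), the equation $\int_{0}^{\infty}s\,W'(cs)\,f\left(s\mid \frac{t}{\lambda}\right)ds=0$ in $c\in(0,\infty)$ has a unique solution $c=\psi_\lambda(t)$, and $f\left(\frac{1}{\psi_\lambda(t)}\,\middle|\, \frac{t}{\lambda}\right)>0$. Let $\delta_\psi(\mathbf{X})=X_2\psi(T)$, with $\psi:(0,\infty)\to(0,\infty)$, be a scale equivariant estimator of $\theta_2$. Let $\underline{\psi}$ and $\overline{\psi}$ be functions on $(0,\infty)$ (with values in $[-\infty,\infty)$ and $(0,\infty]$, respectively) such that $\underline{\psi}(t)<\psi_\lambda(t)<\overline{\psi}(t)$ for all $\lambda\ge 1$ and all $t>0$. Define $$\psi^*(t)=\underline{\psi}(t)\vee(\psi(t)\wedge\overline{\psi}(t))=(\underline{\psi}(t)\vee\psi(t))\wedge\overline{\psi}(t),\qquad t>0,$$ and $\delta_{\psi^*}(\mathbf{X})=X_2\psi^*(T)$. Then $$R_2(\boldsymbol{\theta},\delta_\psi)\ \ge\ R_2(\boldsymbol{\theta},\delta_{\psi^*})\qquad\text{for every }\boldsymbol{\theta}\in\Theta_0 .$$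
   Context: Model: $\mathbf{X}=(X_1,X_2)$ has joint Lebesgue density $\frac{1}{\theta_1\theta_2}f\left(\frac{x_1}{\theta_1},\frac{x_2}{\theta_2}\right)$, where $f$ is a specified probability density whose support is contained in $(0,\infty)^2$, and $\boldsymbol{\theta}=(\theta_1,\theta_2)\in\Theta_0=\{(t_1,t_2)\in(0,\infty)^2: t_1\le t_2\}$ is unknown. Put $T=X_2/X_1$ and $\lambda=\theta_2/\theta_1\in[1,\infty)$. The risk of an estimator $\delta$ of $\theta_2$ is $R_2(\boldsymbol{\theta},\delta)=E_{\boldsymbol{\theta}}\left[W\left(\delta(\mathbf{X})/\theta_2\right)\right]\in[0,\infty]$. A scale equivariant estimator of $\theta_2$ is one of the form $\delta_\psi(\mathbf{X})=X_2\psi(T)$ with $\psi:(0,\infty)\to(0,\infty)$. All functions are Borel measurable. $x\vee y$ and $x\wedge y$ denote the maximum and minimum. Conditional density: $f(s\mid t)=\dfrac{s\,f\left(\frac{s}{t},s\right)}{\int_{0}^{\infty}u\,f\left(\frac{u}{t},u\right)du}$, $s>0$ (the conditional density of $X_2/\theta_2$ given $T=t$ is $f(s\mid t/\lambda)$). *)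

theory Defs
  imports "HOL-Analysis.Analysis"
begin

definition Theta0 :: "(real \<times> real) set" where
  "Theta0 = {(t1, t2). 0 < t1 \<and> 0 < t2 \<and> t1 \<le> t2}"

text \<open>"Support contained in the open quadrant" is read pointwise: the density vanishes off the
  quadrant. The closed support may touch the axes, as for exponential densities.\<close>

definition is_quadrant_density :: "(real \<times> real \<Rightarrow> real) \<Rightarrow> bool" where
  "is_quadrant_density f \<longleftrightarrow>
     f \<in> borel_measurable borel \<and> (\<forall>x. 0 \<le> f x) \<and>
     (\<integral>\<^sup>+ x. ennreal (f x) \<partial>lborel) = 1 \<and>
     {x. f x \<noteq> 0} \<subseteq> {0<..} \<times> {0<..}"

definition model :: "(real \<times> real \<Rightarrow> real) \<Rightarrow> real \<times> real \<Rightarrow> (real \<times> real) measure" where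
  "model f \<theta> = density lborel
     (\<lambda>x. ennreal (1 / (fst \<theta> * snd \<theta>) * f (fst x / fst \<theta>, snd x / snd \<theta>)))"

text \<open>The risk takes values in \<open>[0, \<infinity>]\<close>, hence the nonnegative integral.\<close>

definition risk2 ::
  "(real \<times> real \<Rightarrow> real) \<Rightarrow> (real \<Rightarrow> real) \<Rightarrow> real \<times> real \<Rightarrow> (real \<times> real \<Rightarrow> real) \<Rightarrow> ennreal" where
  "risk2 f W \<theta> \<delta> = (\<integral>\<^sup>+ x. ennreal (W (\<delta> x / snd \<theta>)) \<partial>model f \<theta>)"

definition equivariant_est :: "(real \<Rightarrow> real) \<Rightarrow> real \<times> real \<Rightarrow> real" where
  "equivariant_est \<psi> x = snd x * \<psi> (snd x / fst x)"

definition cond_density :: "(real \<times> real \<Rightarrow> real) \<Rightarrow> real \<Rightarrow> real \<Rightarrow> real" where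
  "cond_density f t s = s * f (s / t, s) / (LBINT u:{0<..}. u * f (u / t, u))"

text \<open>The conditional density at \<open>t\<close> makes sense iff its normalising integral is finite and
  nonzero. Finiteness has to be required separately because the Bochner integral of a
  non-integrable function is \<open>0\<close>.\<close>

definition cond_density_defined :: "(real \<times> real \<Rightarrow> real) \<Rightarrow> real \<Rightarrow> bool" where
  "cond_density_defined f t \<longleftrightarrow>
     set_integrable lborel {0<..} (\<lambda>u. u * f (u / t, u)) \<and>
     0 < (LBINT u:{0<..}. u * f (u / t, u))"

text \<open>For the same reason a solution \<open>c\<close> of the equation must make the integral exist.\<close>

definition solves_psi_eq ::
  "(real \<times> real \<Rightarrow> real) \<Rightarrow> (real \<Rightarrow> real) \<Rightarrow> real \<Rightarrow> real \<Rightarrow> real \<Rightarrow> bool" where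
  "solves_psi_eq f W lam t c \<longleftrightarrow>
     0 < c \<and>
     set_integrable lborel {0<..} (\<lambda>s. s * deriv W (c * s) * cond_density f (t / lam) s) \<and>
     (LBINT s:{0<..}. s * deriv W (c * s) * cond_density f (t / lam) s) = 0"

definition psi_sol ::
  "(real \<times> real \<Rightarrow> real) \<Rightarrow> (real \<Rightarrow> real) \<Rightarrow> real \<Rightarrow> real \<Rightarrow> real" where
  "psi_sol f W lam t = (THE c. solves_psi_eq f W lam t c)"

definition psi_star ::
  "(real \<Rightarrow> ereal) \<Rightarrow> (real \<Rightarrow> ereal) \<Rightarrow> (real \<Rightarrow> real) \<Rightarrow> real \<Rightarrow> real" where
  "psi_star lo up \<psi> t = real_of_ereal (max (lo t) (min (ereal (\<psi> t)) (up t)))"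

text \<open>The conversion to \<open>real\<close> loses nothing under the range conditions on the three functions.\<close>

lemma ereal_psi_star:
  assumes "0 < \<psi> t" "lo t < \<infinity>" "0 < up t"
  shows "ereal (psi_star lo up \<psi> t) = max (lo t) (min (ereal (\<psi> t)) (up t))"
    and "0 < psi_star lo up \<psi> t"
  using assms unfolding psi_star_def
  by (cases "lo t"; cases "up t"; auto simp: max_def min_def)+

end

theory Submission
  imports Defs
begin

text \<open>Conditioning on the ratio \<open>U = (X\<^sub>1 / \<theta>\<^sub>1) / (X\<^sub>2 / \<theta>\<^sub>2)\<close> writes the risk as an integral
  over \<open>u\<close> of the conditional risks \<open>c \<mapsto> \<integral> W (c s) s f (u s, s) ds\<close> at \<open>c = \<psi> (\<lambda> / u)\<close>. Each of these
  is convex in \<open>c\<close> with minimiser \<open>\<psi>\<^sub>\<lambda>\<close>, so moving \<open>c\<close> towards \<open>\<psi>\<^sub>\<lambda>\<close> without overshooting, which is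
  what truncation to an interval containing \<open>\<psi>\<^sub>\<lambda>\<close> does, decreases it. Conditioning on \<open>U\<close> rather
  than on \<open>T = \<lambda> / U\<close> keeps all substitutions linear.\<close>

section \<open>Convexity of the loss and the conditional risk\<close>

text \<open>The mean value theorem gives the increment of \<open>W\<close> as a slope at an
  intermediate point, and monotonicity of \<open>deriv W\<close> compares that slope with the one at
  \<open>y\<close>.\<close>

lemma mono_deriv_tangent_below:
  fixes W :: "real \<Rightarrow> real"
  assumes diff: "\<forall>x>0. W differentiable (at x)"
    and mono: "mono_on {0<..} (deriv W)"
    and x: "0 < x" and y: "0 < y"
  shows "W y + deriv W y * (x - y) \<le> W x"
proof -
  have D: "(W has_real_derivative deriv W z) (at z)" if "0 < z" for z
    using diff that DERIV_deriv_iff_real_differentiable by blast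
  consider "x = y" | "x < y" | "y < x" by linarith
  then show ?thesis
  proof cases
    case 2
    then obtain z where z: "x < z" "z < y" "W y - W x = (y - x) * deriv W z"
      using MVT2[of x y W "deriv W"] D x by force
    have "deriv W z \<le> deriv W y"
      using z x by (intro mono_onD[OF mono]) auto
    then have "(y - x) * deriv W z \<le> (y - x) * deriv W y"
      using 2 by (intro mult_left_mono) auto
    with z(3) show ?thesis by (simp add: algebra_simps)
  next
    case 3
    then obtain z where z: "y < z" "z < x" "W x - W y = (x - y) * deriv W z"
      using MVT2[of y x W "deriv W"] D y by force
    have "deriv W y \<le> deriv W z"
      using z y by (intro mono_onD[OF mono]) auto
    then have "(x - y) * deriv W y \<le> (x - y) * deriv W z"
      using 3 by (intro mult_left_mono) auto
    with z(3) show ?thesis by (simp add: algebra_simps)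
  qed simp
qed

text \<open>The tangent at \<open>b * s\<close> bounds \<open>W (b * s)\<close> by
  \<open>W (a * s)\<close> plus \<open>(b - a) * s * deriv W (b * s)\<close>. As \<open>b\<close>
  lies between \<open>a\<close> and \<open>c\<close>, replacing the slope by the one at
  \<open>c * s\<close> can only enlarge the bound. After integration against \<open>p\<close> the
  correction vanishes by the stationarity equation \<open>zero\<close>. No derivative is taken under
  the integral sign.\<close>

lemma conditional_risk_mono:
  fixes W p :: "real \<Rightarrow> real"
  assumes diff: "\<forall>x>0. W differentiable (at x)"
    and mono: "mono_on {0<..} (deriv W)"
    and W_nonneg: "\<forall>x\<ge>0. 0 \<le> W x"
    and p_nonneg: "\<And>s. 0 < s \<Longrightarrow> 0 \<le> p s"
    and meas: "set_borel_measurable lborel {0<..} (\<lambda>s. W (a * s) * p s)"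
    and int: "set_integrable lborel {0<..} (\<lambda>s. s * deriv W (c * s) * p s)"
    and zero: "(LBINT s:{0<..}. s * deriv W (c * s) * p s) = 0"
    and pos: "0 < a" "0 < b" "0 < c"
    and ord: "a \<le> b \<and> b \<le> c \<or> c \<le> b \<and> b \<le> a"
  shows "(\<integral>\<^sup>+s\<in>{0<..}. ennreal (W (b * s) * p s) \<partial>lborel)
       \<le> (\<integral>\<^sup>+s\<in>{0<..}. ennreal (W (a * s) * p s) \<partial>lborel)"
proof -
  define A where "A s = indicator {0<..} s * (W (a * s) * p s)" for s
  define H where "H s = indicator {0<..} s * (s * deriv W (c * s) * p s)" for s
  have A_nonneg: "0 \<le> A s" for s
    using W_nonneg p_nonneg pos by (auto simp: A_def indicator_def)
  have A_meas: "A \<in> borel_measurable lborel"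
    using meas by (simp add: set_borel_measurable_def A_def[abs_def])
  have H_int: "integrable lborel H"
    using int by (simp add: set_integrable_def H_def[abs_def])
  have H_zero: "integral\<^sup>L lborel H = 0"
    using zero by (simp add: set_lebesgue_integral_def H_def[abs_def])
  have key: "W (b * s) * p s \<le> A s + (b - a) * H s" if s: "0 < s" for s
  proof -
    \<comment> \<open>In both orders \<open>b - a\<close> and \<open>c - b\<close> do not have
      opposite signs, so monotonicity of \<open>deriv W\<close> gives the same inequality.\<close>
    have "(b - a) * deriv W (b * s) \<le> (b - a) * deriv W (c * s)"
      using ord
    proof
      assume "a \<le> b \<and> b \<le> c"
      then show ?thesis
        using s pos by (intro mult_left_mono mono_onD[OF mono]) auto
    next
      assume "c \<le> b \<and> b \<le> a"
      then show ?thesis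
        using s pos by (intro mult_left_mono_neg mono_onD[OF mono]) auto
    qed
    then have "s * ((b - a) * deriv W (b * s)) \<le> s * ((b - a) * deriv W (c * s))"
      by (rule mult_left_mono) (use s in simp)
    moreover have "W (b * s) + deriv W (b * s) * (a * s - b * s) \<le> W (a * s)"
      using s pos by (intro mono_deriv_tangent_below[OF diff mono]) auto
    ultimately have "W (b * s) \<le> W (a * s) + (b - a) * (s * deriv W (c * s))"
      by (simp add: algebra_simps)
    then have "W (b * s) * p s \<le> (W (a * s) + (b - a) * (s * deriv W (c * s))) * p s"
      by (rule mult_right_mono) (rule p_nonneg[OF s])
    with s show ?thesis by (simp add: A_def H_def algebra_simps)
  qed
  \<comment> \<open>\<open>H\<close> may change sign, so nonnegativity has to come from the quantity
    that the sum dominates. It permits passing from the nonnegative integral to the Bochner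
    integral.\<close>
  have sum_nonneg: "0 \<le> A s + (b - a) * H s" for s
  proof (cases "0 < s")
    case True
    then have "0 \<le> W (b * s) * p s"
      using W_nonneg p_nonneg pos by simp
    with key[OF True] show ?thesis by linarith
  qed (simp add: A_def H_def)
  have A_eq: "(\<integral>\<^sup>+s\<in>{0<..}. ennreal (W (a * s) * p s) \<partial>lborel) = (\<integral>\<^sup>+s. ennreal (A s) \<partial>lborel)"
    by (intro nn_integral_cong) (simp add: A_def indicator_def)
  show ?thesis
  \<comment> \<open>An infinite risk at \<open>a\<close> leaves nothing to prove. A finite one makes
    \<open>A\<close> integrable, so that the integral of \<open>H\<close> can be split off.\<close>
  proof (cases "(\<integral>\<^sup>+s. ennreal (A s) \<partial>lborel) = \<infinity>")
    case True
    then show ?thesis by (simp add: A_eq)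
  next
    case False
    then have A_int: "integrable lborel A"
      using A_meas A_nonneg by (intro integrableI_nonneg) (auto simp: less_top)
    have "(\<integral>\<^sup>+s\<in>{0<..}. ennreal (W (b * s) * p s) \<partial>lborel)
        \<le> (\<integral>\<^sup>+s. ennreal (A s + (b - a) * H s) \<partial>lborel)"
      using key by (intro nn_integral_mono) (auto simp: indicator_def intro: ennreal_leI)
    also have "\<dots> = ennreal (\<integral>s. A s + (b - a) * H s \<partial>lborel)"
      using A_int H_int sum_nonneg by (intro nn_integral_eq_integral) auto
    also have "(\<integral>s. A s + (b - a) * H s \<partial>lborel) = integral\<^sup>L lborel A"
      using A_int H_int H_zero by simp
    also have "ennreal (integral\<^sup>L lborel A) = (\<integral>\<^sup>+s. ennreal (A s) \<partial>lborel)"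
      using A_int A_nonneg by (intro nn_integral_eq_integral[symmetric]) auto
    finally show ?thesis by (simp add: A_eq)
  qed
qed

section \<open>Ratio coordinates and the disintegration of the risk\<close>

text \<open>The substitution \<open>x = (a * (u * s), b * s)\<close> has Jacobian
  \<open>a * b * s\<close> on the quadrant. It is carried out as two affine substitutions on the
  line: \<open>b * s\<close> for the second coordinate, then \<open>a * s * u\<close> for the first
  with \<open>s\<close> fixed. Tonelli then moves \<open>u\<close> to the outside.\<close>

lemma nn_integral_ratio_coordinates:
  fixes F :: "real \<times> real \<Rightarrow> ennreal"
  assumes F[measurable]: "F \<in> borel_measurable borel"
    and supp: "\<And>x. x \<notin> {0<..} \<times> {0<..} \<Longrightarrow> F x = 0"
    and pos: "0 < a" "0 < b"
  shows "(\<integral>\<^sup>+x. F x \<partial>lborel)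
       = (\<integral>\<^sup>+u\<in>{0<..}. (\<integral>\<^sup>+s\<in>{0<..}. ennreal (a * b * s) * F (a * (u * s), b * s) \<partial>lborel) \<partial>lborel)"
proof -
  have inner: "(\<integral>\<^sup>+x. F (x, b * s) \<partial>lborel)
      = (\<integral>\<^sup>+u. ennreal \<bar>a * s\<bar> * F (a * (u * s), b * s) \<partial>lborel)" for s
  proof (cases "s = 0")
    \<comment> \<open>The substitution degenerates here, but both sides are zero: \<open>F\<close>
      vanishes on the axis and the Jacobian factor is zero.\<close>
    case True
    then show ?thesis using supp by simp
  next
    case False
    have "(\<integral>\<^sup>+x. F (x, b * s) \<partial>lborel)
        = ennreal \<bar>a * s\<bar> * (\<integral>\<^sup>+u. F (0 + (a * s) * u, b * s) \<partial>lborel)"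
      using False pos by (intro nn_integral_real_affine) auto
    also have "\<dots> = (\<integral>\<^sup>+u. ennreal \<bar>a * s\<bar> * F (a * (u * s), b * s) \<partial>lborel)"
      by (subst nn_integral_cmult[symmetric]) (auto simp: ac_simps)
    finally show ?thesis .
  qed
  have "(\<integral>\<^sup>+x. F x \<partial>lborel) = (\<integral>\<^sup>+y. (\<integral>\<^sup>+x. F (x, y) \<partial>lborel) \<partial>lborel)"
    by (subst lborel_pair.nn_integral_snd) (simp_all add: lborel_prod)
  also have "\<dots> = ennreal \<bar>b\<bar> * (\<integral>\<^sup>+s. (\<integral>\<^sup>+x. F (x, 0 + b * s) \<partial>lborel) \<partial>lborel)"
    using pos by (intro nn_integral_real_affine) auto
  also have "\<dots> = (\<integral>\<^sup>+s. ennreal \<bar>b\<bar> * (\<integral>\<^sup>+u. ennreal \<bar>a * s\<bar> * F (a * (u * s), b * s) \<partial>lborel) \<partial>lborel)"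
    by (subst nn_integral_cmult[symmetric]) (auto simp: inner)
  also have "\<dots> = (\<integral>\<^sup>+s. (\<integral>\<^sup>+u. ennreal \<bar>b\<bar> * (ennreal \<bar>a * s\<bar> * F (a * (u * s), b * s)) \<partial>lborel) \<partial>lborel)"
    by (intro nn_integral_cong nn_integral_cmult[symmetric]) auto
  also have "\<dots> = (\<integral>\<^sup>+u. (\<integral>\<^sup>+s. ennreal \<bar>b\<bar> * (ennreal \<bar>a * s\<bar> * F (a * (u * s), b * s)) \<partial>lborel) \<partial>lborel)"
    by (intro lborel_pair.Fubini') auto
  also have "\<dots> = (\<integral>\<^sup>+u\<in>{0<..}. (\<integral>\<^sup>+s\<in>{0<..}. ennreal (a * b * s) * F (a * (u * s), b * s) \<partial>lborel) \<partial>lborel)"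
  proof (intro nn_integral_cong)
    fix u :: real
    have "ennreal \<bar>b\<bar> * (ennreal \<bar>a * s\<bar> * F (a * (u * s), b * s))
        = ennreal (a * b * s) * F (a * (u * s), b * s) * indicator {0<..} s * indicator {0<..} u" for s
    proof (cases "0 < s \<and> 0 < u")
      case True
      then show ?thesis
        using pos by (simp add: abs_mult ennreal_mult ac_simps)
    next
      case False
      then have "F (a * (u * s), b * s) = 0"
        using pos by (intro supp) (auto simp: zero_less_mult_iff)
      then show ?thesis by simp
    qed
    then show "(\<integral>\<^sup>+s. ennreal \<bar>b\<bar> * (ennreal \<bar>a * s\<bar> * F (a * (u * s), b * s)) \<partial>lborel)
        = (\<integral>\<^sup>+s\<in>{0<..}. ennreal (a * b * s) * F (a * (u * s), b * s) \<partial>lborel) * indicator {0<..} u"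
      by (simp add: nn_integral_multc)
  qed
  finally show ?thesis .
qed

lemma is_quadrant_densityD:
  assumes "is_quadrant_density f"
  shows "f \<in> borel_measurable borel" "0 \<le> f x"
    and "(\<integral>\<^sup>+x. ennreal (f x) \<partial>lborel) = 1"
    and "x \<notin> {0<..} \<times> {0<..} \<Longrightarrow> f x = 0"
  using assms unfolding is_quadrant_density_def by blast+

text \<open>In the coordinates \<open>x = (a * (u * s), b * s)\<close> the ratio
  \<open>snd x / fst x\<close> is \<open>b / a / u\<close> and the scaled observation
  \<open>snd x / b\<close> is \<open>s\<close>. The factor \<open>1 / (a * b)\<close> of the density
  cancels against the Jacobian and leaves the weight \<open>s * f (u * s, s)\<close>, which is the
  conditional density up to a factor depending on \<open>u\<close> only.\<close>

lemma risk2_equivariant_eq: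
  assumes f: "is_quadrant_density f"
    and W_meas: "W \<in> borel_measurable (restrict_space borel {0..})"
    and W_nonneg: "\<forall>x\<ge>0. 0 \<le> W x"
    and \<psi>_meas: "\<psi> \<in> borel_measurable (restrict_space borel {0<..})"
    and \<psi>_pos: "\<forall>t>0. 0 < \<psi> t"
    and pos: "0 < a" "0 < b"
  shows "risk2 f W (a, b) (equivariant_est \<psi>)
    = (\<integral>\<^sup>+u\<in>{0<..}. (\<integral>\<^sup>+s\<in>{0<..}. ennreal (W (\<psi> (b / a / u) * s) * (s * f (u * s, s))) \<partial>lborel) \<partial>lborel)"
proof -
  \<comment> \<open>\<open>W\<close> and \<open>\<psi>\<close> are measurable only on half-lines;
    extension by zero gives Borel functions on the whole line.\<close>
  define W0 where "W0 x = indicator {0..} x * W x" for x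
  define \<psi>0 where "\<psi>0 t = indicator {0<..} t * \<psi> t" for t
  note [measurable] = is_quadrant_densityD(1)[OF f]
  have [measurable]: "W0 \<in> borel_measurable borel"
    using W_meas by (simp add: borel_measurable_restrict_space_iff W0_def[abs_def])
  have [measurable]: "\<psi>0 \<in> borel_measurable borel"
    using \<psi>_meas by (simp add: borel_measurable_restrict_space_iff \<psi>0_def[abs_def])
  define d where "d x = ennreal (1 / (a * b) * f (fst x / a, snd x / b))" for x
  define g where "g x = ennreal (W0 (snd x * \<psi>0 (snd x / fst x) / b))" for x
  have [measurable]: "fst \<in> borel_measurable (borel :: (real \<times> real) measure)"
      "snd \<in> borel_measurable (borel :: (real \<times> real) measure)"
    by (auto intro!: borel_measurable_continuous_onI continuous_intros)
  have [measurable]: "d \<in> borel_measurable borel" "g \<in> borel_measurable borel"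
    by (auto simp: d_def[abs_def] g_def[abs_def])
  have d0: "d x = 0" if "x \<notin> {0<..} \<times> {0<..}" for x
  proof -
    have "f (fst x / a, snd x / b) = 0"
      using that pos by (intro is_quadrant_densityD(4)[OF f]) (auto simp: zero_less_divide_iff mem_Times_iff)
    then show ?thesis by (simp add: d_def)
  qed
  have model: "model f (a, b) = density lborel d"
    by (simp add: model_def d_def[abs_def])
  \<comment> \<open>Where \<open>d\<close> is positive both coordinates are positive, and there the
    extensions by zero agree with the original functions.\<close>
  have "AE x in density lborel d. ennreal (W (equivariant_est \<psi> x / b)) = g x"
  proof (subst AE_density, simp, intro AE_I2 impI)
    fix x assume "0 < d x"
    then have "x \<in> {0<..} \<times> {0<..}" using d0[of x] by fastforce
    then have x: "0 < fst x" "0 < snd x" by (auto simp: mem_Times_iff)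
    then have "0 < \<psi> (snd x / fst x)" using \<psi>_pos by simp
    with x pos show "ennreal (W (equivariant_est \<psi> x / b)) = g x"
      by (simp add: g_def W0_def \<psi>0_def equivariant_est_def)
  qed
  then have "risk2 f W (a, b) (equivariant_est \<psi>) = (\<integral>\<^sup>+x. g x \<partial>density lborel d)"
    unfolding risk2_def model by (intro nn_integral_cong_AE) simp
  also have "\<dots> = (\<integral>\<^sup>+x. d x * g x \<partial>lborel)"
    by (intro nn_integral_density) auto
  also have "\<dots> = (\<integral>\<^sup>+u\<in>{0<..}. (\<integral>\<^sup>+s\<in>{0<..}. ennreal (a * b * s) *
        (d (a * (u * s), b * s) * g (a * (u * s), b * s)) \<partial>lborel) \<partial>lborel)"
    using pos d0 by (intro nn_integral_ratio_coordinates) auto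
  also have "\<dots> = (\<integral>\<^sup>+u\<in>{0<..}. (\<integral>\<^sup>+s\<in>{0<..}. ennreal (W (\<psi> (b / a / u) * s) * (s * f (u * s, s))) \<partial>lborel) \<partial>lborel)"
  proof -
    have "ennreal (a * b * s) * (d (a * (u * s), b * s) * g (a * (u * s), b * s))
        = ennreal (W (\<psi> (b / a / u) * s) * (s * f (u * s, s)))" if "0 < u" "0 < s" for u s
    proof -
      have \<psi>u: "0 < \<psi> (b / a / u)" using \<psi>_pos pos that by simp
      have "b * s / (a * (u * s)) = b / a / u" using that pos by simp
      then have "g (a * (u * s), b * s) = ennreal (W (\<psi> (b / a / u) * s))"
        using pos that \<psi>u by (simp add: g_def W0_def \<psi>0_def ac_simps)
      moreover have "d (a * (u * s), b * s) = ennreal (1 / (a * b) * f (u * s, s))"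
        using pos by (simp add: d_def)
      moreover have "0 \<le> W (\<psi> (b / a / u) * s)" using W_nonneg \<psi>u that by simp
      ultimately show ?thesis
        using pos that is_quadrant_densityD(2)[OF f]
        by (simp flip: ennreal_mult)
    qed
    then show ?thesis
      by (auto intro!: nn_integral_cong simp: indicator_def)
  qed
  finally show ?thesis .
qed

text \<open>With unit scales the ratio coordinates write the total mass 1 as the integral of these
  masses over \<open>u\<close>, so they are finite almost everywhere. This excludes the
  \<open>u\<close> with infinite normaliser, where the conditional density is undefined.\<close>

lemma AE_ratio_mass_finite:
  assumes f: "is_quadrant_density f"
  shows "AE u in lborel. 0 < u \<longrightarrow> (\<integral>\<^sup>+s\<in>{0<..}. ennreal (s * f (u * s, s)) \<partial>lborel) < \<infinity>"
proof -
  note [measurable] = is_quadrant_densityD(1)[OF f]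
  let ?m = "\<lambda>u. (\<integral>\<^sup>+s\<in>{0<..}. ennreal (s * f (u * s, s)) \<partial>lborel)"
  have "1 = (\<integral>\<^sup>+u\<in>{0<..}. (\<integral>\<^sup>+s\<in>{0<..}. ennreal (1 * 1 * s) *
      ennreal (f (1 * (u * s), 1 * s)) \<partial>lborel) \<partial>lborel)"
    unfolding is_quadrant_densityD(3)[OF f, symmetric]
    by (rule nn_integral_ratio_coordinates) (auto simp: is_quadrant_densityD(4)[OF f])
  also have "\<dots> = (\<integral>\<^sup>+u. ?m u * indicator {0<..} u \<partial>lborel)"
    by (auto intro!: nn_integral_cong simp: indicator_def ennreal_mult is_quadrant_densityD(2)[OF f])
  finally have "(\<integral>\<^sup>+u. ?m u * indicator {0<..} u \<partial>lborel) \<noteq> \<infinity>"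
    by simp
  then have "AE u in lborel. ?m u * indicator {0<..} u \<noteq> \<infinity>"
    by (intro nn_integral_noteq_infinite) auto
  then show ?thesis
    by eventually_elim (auto simp: less_top)
qed

section \<open>Truncation\<close>

lemma psi_star_borel_measurable:
  assumes [measurable]: "\<psi> \<in> borel_measurable M" "lo \<in> borel_measurable M" "up \<in> borel_measurable M"
  shows "psi_star lo up \<psi> \<in> borel_measurable M"
  unfolding psi_star_def[abs_def] by measurable

text \<open>Clipping moves a value outside the interval only as far as the nearer endpoint, and
  \<open>c\<close> lies strictly beyond that endpoint.\<close>

lemma psi_star_between:
  assumes "0 < \<psi> t" "lo t < \<infinity>" "0 < up t" "lo t < ereal c" "ereal c < up t"
  shows "\<psi> t \<le> psi_star lo up \<psi> t \<and> psi_star lo up \<psi> t \<le> c \<or>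
    c \<le> psi_star lo up \<psi> t \<and> psi_star lo up \<psi> t \<le> \<psi> t \<or> psi_star lo up \<psi> t = \<psi> t"
  using assms unfolding psi_star_def
  by (cases "lo t"; cases "up t"; auto simp: max_def min_def)

section \<open>Comparison of the risks\<close>

theorem theorem3p2p1:
  fixes f :: "real \<times> real \<Rightarrow> real"
    and W :: "real \<Rightarrow> real"
    and \<psi> :: "real \<Rightarrow> real"
    and lo up :: "real \<Rightarrow> ereal"
  assumes f: "is_quadrant_density f"
    and W_meas: "W \<in> borel_measurable (restrict_space borel {0..})"
    and W_nonneg: "\<forall>x\<ge>0. 0 \<le> W x"
    and W_one: "W 1 = 0"
    and W_decr: "antimono_on {0<..1} W"
    and W_incr: "mono_on {1..} W"
    and W_diff: "\<forall>x>0. W differentiable (at x)"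
    and W_deriv_mono: "mono_on {0<..} (deriv W)"
    and unique_sol: "\<forall>lam\<ge>1. \<forall>t>0. cond_density_defined f (t / lam) \<longrightarrow>
           (\<exists>!c. solves_psi_eq f W lam t c)"
    and pos_at_sol: "\<forall>lam\<ge>1. \<forall>t>0. cond_density_defined f (t / lam) \<longrightarrow>
           0 < cond_density f (t / lam) (1 / psi_sol f W lam t)"
    and psi_meas: "\<psi> \<in> borel_measurable (restrict_space borel {0<..})"
    and psi_pos: "\<forall>t>0. 0 < \<psi> t"
    and lo_meas: "lo \<in> borel_measurable (restrict_space borel {0<..})"
    and up_meas: "up \<in> borel_measurable (restrict_space borel {0<..})"
    and lo_range: "\<forall>t>0. lo t < \<infinity>"
    and up_range: "\<forall>t>0. 0 < up t"
    and bounds: "\<forall>lam\<ge>1. \<forall>t>0. cond_density_defined f (t / lam) \<longrightarrow>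
           lo t < ereal (psi_sol f W lam t) \<and> ereal (psi_sol f W lam t) < up t"
  shows "(\<forall>t>0. (\<exists>lam\<ge>1. cond_density_defined f (t / lam)) \<longrightarrow>
            max (lo t) (min (ereal (\<psi> t)) (up t)) = min (max (lo t) (ereal (\<psi> t))) (up t)) \<and>
         (\<forall>\<theta>\<in>Theta0. risk2 f W \<theta> (equivariant_est \<psi>)
            \<ge> risk2 f W \<theta> (equivariant_est (psi_star lo up \<psi>)))"
proof
  show "\<forall>t>0. (\<exists>lam\<ge>1. cond_density_defined f (t / lam)) \<longrightarrow>
      max (lo t) (min (ereal (\<psi> t)) (up t)) = min (max (lo t) (ereal (\<psi> t))) (up t)"
  proof (intro allI impI)
    fix t :: real assume "0 < t" "\<exists>lam\<ge>1. cond_density_defined f (t / lam)"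
    \<comment> \<open>A single \<open>lam\<close> with defined conditional density suffices, since
      its solution separates the two bounds.\<close>
    then have "lo t < up t" using bounds by (meson less_trans)
    then show "max (lo t) (min (ereal (\<psi> t)) (up t)) = min (max (lo t) (ereal (\<psi> t))) (up t)"
      by (auto simp: max_def min_def)
  qed
  let ?\<psi>' = "psi_star lo up \<psi>"
  have \<psi>'_pos: "\<forall>t>0. 0 < ?\<psi>' t"
    using ereal_psi_star(2) psi_pos lo_range up_range by blast
  note \<psi>'_meas = psi_star_borel_measurable[OF psi_meas lo_meas up_meas]
  note f_nonneg = is_quadrant_densityD(2)[OF f]
  have [measurable]: "f \<in> borel_measurable borel" by (rule is_quadrant_densityD(1)[OF f])
  define W0 where "W0 x = indicator {0..} x * W x" for x
  have [measurable]: "W0 \<in> borel_measurable borel"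
    using W_meas by (simp add: borel_measurable_restrict_space_iff W0_def[abs_def])
  show "\<forall>\<theta>\<in>Theta0. risk2 f W \<theta> (equivariant_est \<psi>) \<ge> risk2 f W \<theta> (equivariant_est ?\<psi>')"
  proof
    fix \<theta> assume "\<theta> \<in> Theta0"
    then obtain a b where \<theta>: "\<theta> = (a, b)" and ab: "0 < a" "0 < b" "a \<le> b"
      by (auto simp: Theta0_def)
    define lam where "lam = b / a"
    have lam: "1 \<le> lam" using ab by (simp add: lam_def)
    let ?r = "\<lambda>\<psi> u. \<integral>\<^sup>+s\<in>{0<..}. ennreal (W (\<psi> (lam / u) * s) * (s * f (u * s, s))) \<partial>lborel"
    have "?r ?\<psi>' u \<le> ?r \<psi> u"
      if u: "0 < u" and fin: "(\<integral>\<^sup>+s\<in>{0<..}. ennreal (s * f (u * s, s)) \<partial>lborel) < \<infinity>" for u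
    proof -
      define p where "p s = s * f (u * s, s)" for s
      have p_meas[measurable]: "p \<in> borel_measurable borel" by (simp add: p_def[abs_def])
      have p_nonneg: "0 \<le> p s" if "0 < s" for s using that f_nonneg by (simp add: p_def)
      \<comment> \<open>The ratio \<open>T\<close> equals \<open>lam / u\<close>, so the conditional
        density is taken at \<open>1 / u\<close>, where it is \<open>p\<close> divided by its mass
        \<open>m\<close>.\<close>
      have tlam: "lam / u / lam = 1 / u" using lam by simp
      have t: "0 < lam / u" using lam u by simp
      have p_alt: "v * f (v / (1 / u), v) = p v" for v by (simp add: p_def mult.commute)
      define m where "m = (LBINT s:{0<..}. p s)"
      have p_int: "set_integrable lborel {0<..} p"
        unfolding set_integrable_def
        using p_nonneg fin by (intro integrableI_nonneg)
          (auto simp: indicator_def p_def if_distrib cong: if_cong elim!: order.strict_trans1[rotated] intro!: nn_integral_mono)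
      have m_nonneg: "0 \<le> m"
        unfolding m_def set_lebesgue_integral_def
        by (rule Bochner_Integration.integral_nonneg) (auto simp: indicator_def intro: p_nonneg)
      have p_nn: "(\<integral>\<^sup>+s\<in>{0<..}. ennreal (p s) \<partial>lborel) = ennreal m"
      proof -
        have "(\<integral>\<^sup>+s\<in>{0<..}. ennreal (p s) \<partial>lborel)
            = (\<integral>\<^sup>+s. ennreal (indicator {0<..} s *\<^sub>R p s) \<partial>lborel)"
          by (intro nn_integral_cong) (simp add: indicator_def)
        also have "\<dots> = ennreal m"
          unfolding m_def set_lebesgue_integral_def using p_int p_nonneg
          by (intro nn_integral_eq_integral) (auto simp: set_integrable_def indicator_def)
        finally show ?thesis .
      qed
      show ?thesis
      proof (cases "m = 0")
        \<comment> \<open>Zero mass leaves the conditional density undefined, and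
          \<open>bounds\<close> gives no information. But \<open>p\<close> then vanishes almost
          everywhere on the half-line, so the conditional risk of the truncated estimator is
          zero.\<close>
        case True
        with p_nn have "(\<integral>\<^sup>+s\<in>{0<..}. ennreal (p s) \<partial>lborel) = 0"
          by simp
        then have "AE s in lborel. ennreal (p s) * indicator {0<..} s = 0"
          by (intro nn_integral_0_iff_AE[THEN iffD1]) auto
        then have "AE s in lborel. ennreal (W (?\<psi>' (lam / u) * s) * p s) * indicator {0<..} s = 0"
        proof eventually_elim
          case (elim s)
          then show ?case using p_nonneg[of s] by (cases "0 < s") (auto simp: ennreal_eq_0_iff)
        qed
        then have "?r ?\<psi>' u = (\<integral>\<^sup>+s. 0 \<partial>(lborel :: real measure))"
          unfolding p_def by (rule nn_integral_cong_AE)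
        then show ?thesis by simp
      next
        case False
        with m_nonneg have m_pos: "0 < m" by simp
        then have def: "cond_density_defined f (lam / u / lam)"
          unfolding tlam cond_density_defined_def p_alt using p_int by (simp add: m_def)
        define c where "c = psi_sol f W lam (lam / u)"
        have "solves_psi_eq f W lam (lam / u) c"
          unfolding c_def psi_sol_def
          by (rule theI'[OF unique_sol[rule_format, OF lam t def]])
        moreover have cd: "cond_density f (1 / u) s = p s / m" for s
          unfolding cond_density_def p_alt m_def ..
        ultimately have c: "0 < c"
          and c_int: "set_integrable lborel {0<..} (\<lambda>s. s * deriv W (c * s) * p s / m)"
          and c_zero: "(LBINT s:{0<..}. s * deriv W (c * s) * p s / m) = 0"
          unfolding solves_psi_eq_def tlam by simp_all
        have c_int': "set_integrable lborel {0<..} (\<lambda>s. s * deriv W (c * s) * p s)"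
          using c_int m_pos by simp
        have c_zero': "(LBINT s:{0<..}. s * deriv W (c * s) * p s) = 0"
          using c_zero m_pos by simp
        have "set_borel_measurable lborel {0<..} (\<lambda>s. W (\<psi> (lam / u) * s) * p s)"
        proof -
          define e where "e = \<psi> (lam / u)"
          have e: "0 < e" using psi_pos t by (simp add: e_def)
          have "(\<lambda>s. indicator {0<..} s * (W0 (e * s) * p s)) \<in> borel_measurable borel"
            by measurable
          also have "(\<lambda>s. indicator {0<..} s * (W0 (e * s) * p s))
              = (\<lambda>s. indicator {0<..} s *\<^sub>R (W (e * s) * p s))"
            using e by (auto simp: W0_def indicator_def fun_eq_iff)
          finally show ?thesis by (simp add: set_borel_measurable_def e_def)
        qed
        note mono = conditional_risk_mono[OF W_diff W_deriv_mono W_nonneg p_nonneg this c_int' c_zero']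
        have "lo (lam / u) < ereal c" "ereal c < up (lam / u)"
          using bounds lam t def by (auto simp: c_def)
        with psi_star_between[of \<psi> "lam / u" lo up c] psi_pos lo_range up_range t
        consider "\<psi> (lam / u) \<le> ?\<psi>' (lam / u) \<and> ?\<psi>' (lam / u) \<le> c \<or>
            c \<le> ?\<psi>' (lam / u) \<and> ?\<psi>' (lam / u) \<le> \<psi> (lam / u)" | "?\<psi>' (lam / u) = \<psi> (lam / u)"
          by blast
        then show ?thesis
        proof cases
          case 1
          then show ?thesis
            using mono[of "?\<psi>' (lam / u)"] psi_pos \<psi>'_pos t c by (simp add: p_def)
        qed simp
      qed
    qed
    \<comment> \<open>The pointwise comparison covers every positive \<open>u\<close> of finite
      mass; the remaining positive \<open>u\<close> form a null set.\<close>
    then have "AE u in lborel. ?r ?\<psi>' u * indicator {0<..} u \<le> ?r \<psi> u * indicator {0<..} u"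
      using AE_ratio_mass_finite[OF f] by (auto simp: indicator_def elim!: eventually_mono)
    then have "(\<integral>\<^sup>+u\<in>{0<..}. ?r ?\<psi>' u \<partial>lborel) \<le> (\<integral>\<^sup>+u\<in>{0<..}. ?r \<psi> u \<partial>lborel)"
      by (rule nn_integral_mono_AE)
    then show "risk2 f W \<theta> (equivariant_est \<psi>) \<ge> risk2 f W \<theta> (equivariant_est ?\<psi>')"
      unfolding \<theta> lam_def
      using risk2_equivariant_eq[OF f W_meas W_nonneg psi_meas psi_pos ab(1,2)]
        risk2_equivariant_eq[OF f W_meas W_nonneg \<psi>'_meas \<psi>'_pos ab(1,2)] by simp
  qed
qed

end
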